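(* Let $m\ge0$, let $\{\mathcal{L}_\lambda\}$ be a family of distributions indexed by a real parameter $\lambda$, and let $Z_\lambda\sim\mathcal{L}_\lambda$ with $EZ_\lambda^{2m}<\infty$. Suppose the polynomials $\{P_\lambda^k(x)\}_{0\le k\le m}$ are monic, have degree $k$, are orthogonal with respect to $\mathcal{L}_\lambda$, and satisfy $E[P_\lambda^k(Z_\lambda)]^2>0$. For $0\le k\le m$ set $$\alpha_\lambda^{(k)}=\frac1{k!}E\big[Z_\lambda^kP_\lambda^k(Z_\lambda)\big].$$ Then for all $X\in\mathcal{M}_\lambda^k$, where $$\mathcal{M}_\lambda^k=\{X: EX^j=EZ_\lambda^j,\ 0\le j\le 2k\},$$ there exists a random variable $X_\lambda^{(k)}$ such that for all $F\in\mathcal{F}^k(P_\lambda^k)$ $$E\,P_\lambda^k(X)F(X)=\alpha_\lambda^{(k)}\,E\,F^{(k)}(X_\lambda^{(k)}).$$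
   Context: Orthogonality with respect to $\mathcal{L}_\lambda$ means $E[P_\lambda^j(Z_\lambda)P_\lambda^k(Z_\lambda)]=0$ for $j\ne k$. For the given $X$, $\mathcal{F}^k(P)$ is the set of functions $F:\mathbf{R}\to\mathbf{R}$ whose $k$-th derivative $F^{(k)}$ exists and is measurable on $\mathbf{R}$ and for which $E|P(X)F(X)|<\infty$.
   Formalization: The identity is proved for those F in the class for which E F^(k)(X^(k)) is defined in [-∞,∞] (its finiteness is then proved); without this it fails, e.g. k=1, X=Z=±1 with probability 1/2 each, F(x)=x+x² sin(1/x²), F(0)=0. *)

theory Defs
  imports "HOL-Probability.Probability" "HOL-Computational_Algebra.Polynomial"
begin

text \<open>
  Random variables are pairs of a probability space and a measurable real function on it.
  The class \<open>diff_class k p N X\<close> is $\mathcal{F}^k(p)$ for the variable \<open>X\<close> on \<open>N\<close>.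
  The iterate \<open>(deriv ^^ k) F\<close> is the genuine \<open>k\<close>-th derivative only because all lower iterates
  are required to be differentiable at every point (\<open>deriv\<close> is total).
\<close>

definition diff_class :: "nat \<Rightarrow> (real \<Rightarrow> real) \<Rightarrow> 'b measure \<Rightarrow> ('b \<Rightarrow> real) \<Rightarrow> (real \<Rightarrow> real) set" where
  "diff_class k p N X =
     {F. (\<forall>j<k. \<forall>x. (deriv ^^ j) F differentiable (at x)) \<and>
         (deriv ^^ k) F \<in> borel_measurable borel \<and>
         integrable N (\<lambda>w. p (X w) * F (X w))}"

text \<open>Equality of moments includes that the moments exist: the Bochner integral of a
  non-integrable function is 0.\<close>

definition moment_class :: "nat \<Rightarrow> 'a measure \<Rightarrow> ('a \<Rightarrow> real) \<Rightarrow> 'b measure \<Rightarrow> ('b \<Rightarrow> real) set" where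
  "moment_class k M Z N =
     {X \<in> borel_measurable N. \<forall>j\<le>2 * k.
         integrable M (\<lambda>w. Z w ^ j) \<and> integrable N (\<lambda>w. X w ^ j) \<and>
         (LINT w|N. X w ^ j) = (LINT w|M. Z w ^ j)}"

definition orthogonal_upto :: "nat \<Rightarrow> (nat \<Rightarrow> real poly) \<Rightarrow> 'a measure \<Rightarrow> ('a \<Rightarrow> real) \<Rightarrow> bool" where
  "orthogonal_upto m P M Z \<longleftrightarrow>
     (\<forall>j\<le>m. \<forall>k\<le>m. j \<noteq> k \<longrightarrow> (LINT w|M. poly (P j) (Z w) * poly (P k) (Z w)) = 0)"

definition alpha :: "nat \<Rightarrow> (nat \<Rightarrow> real poly) \<Rightarrow> 'a measure \<Rightarrow> ('a \<Rightarrow> real) \<Rightarrow> real" where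
  "alpha k P M Z = (LINT w|M. Z w ^ k * poly (P k) (Z w)) / fact k"

text \<open>
  The expectation of \<open>Y\<close> is defined, with a value in $[-\infty,\infty]$, if its positive part or
  its negative part has finite expectation.  This has to be made explicit because membership in
  \<open>diff_class\<close> does not imply that \<open>(deriv ^^ k) F\<close> has an expectation under the transformed law:
  take \<open>k = 1\<close>, \<open>X = Z = \<plusminus>1\<close> with probability 1/2 each, \<open>p x = x\<close>, so that the transformed law is
  uniform on $[-1,1]$, and \<open>F x = x + x\<^sup>2 sin (1 / x\<^sup>2)\<close>.
\<close>

definition has_expectation :: "'c measure \<Rightarrow> ('c \<Rightarrow> real) \<Rightarrow> bool" where
  "has_expectation M Y \<longleftrightarrow> Y \<in> borel_measurable M \<and>
     ((\<integral>\<^sup>+ w. ennreal (Y w) \<partial>M) < \<infinity> \<or> (\<integral>\<^sup>+ w. ennreal (- Y w) \<partial>M) < \<infinity>)"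

end

theory Submission
  imports Defs
begin

text \<open>
  Write \<open>p\<close> for the polynomial of degree \<open>k > 0\<close>. Agreement of the moments up to order \<open>2 k\<close>
  carries over to \<open>X\<close> that \<open>p\<close> is orthogonal to all polynomials of lower degree and that
  \<open>p (X)\<close> has positive second moment, which is \<open>k! \<alpha>\<close>. Hence \<open>p\<close> has \<open>k\<close> distinct real roots
  (\<open>orthogonal_poly_splits\<close>).

  Let \<open>Q\<close> interpolate \<open>F\<close> at these roots. Orthogonality gives
  \<open>E p(X) F(X) = E p(X) (F(X) - Q(X))\<close>, and Peano's form of the interpolation error is
  \<open>F x - Q x = \<integral> F\<^sup>(\<^sup>k\<^sup>)(u) K(x, u) du\<close> (\<open>peano_kernel_has_integral\<close>). The kernel changes sign with
  \<open>p\<close>: \<open>p x * K(x, u) \<ge> 0\<close> (\<open>peano_kernel_sign\<close>). So \<open>u \<mapsto> E p(X) K(X, u) / \<alpha>\<close> is nonnegative; it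
  is a probability density by the case \<open>F x = x\<^sup>k / k!\<close>, and a variable with this density is the
  one required.

  The delicate point is the exchange of the two integrals. The \<open>k\<close>-th derivative of \<open>F\<close> exists
  everywhere but need not be locally Lebesgue integrable, so that the error formula holds in the
  sense of Henstock and Kurzweil only. If, however, one of the two parts of \<open>F\<^sup>(\<^sup>k\<^sup>)\<close> has finite
  expectation under the new law, Tonelli's theorem makes that part Lebesgue integrable against
  almost every kernel \<open>u \<mapsto> p(X) K(X, u)\<close>. The known value of the signed integral then controls
  the other part, first for each value of \<open>X\<close> and, since \<open>p(X) (F(X) - Q(X))\<close> is integrable, in the
  mean (\<open>mixture_expectation\<close>).
\<close>

section \<open>Intersections of a truncated power with a polynomial\<close>

text \<open>
  Rolle's theorem between consecutive zeros. The bound by the maximum is there for the induction: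
  it keeps the zero that the next interval contributes distinct from the earlier ones.
\<close>
lemma Rolle_finite_zeros:
  fixes g g' :: "real \<Rightarrow> real"
  assumes "finite S" and "\<And>x. x \<in> S \<Longrightarrow> g x = 0" and der: "\<And>x. (g has_real_derivative g' x) (at x)"
  shows "\<exists>T. finite T \<and> card T = card S - 1 \<and> (\<forall>t\<in>T. g' t = 0 \<and> t < Max S)"
  using assms(1,2)
proof (induction S rule: finite_linorder_max_induct)
  case empty
  then show ?case by (intro exI[of _ "{}"]) auto
next
  case (insert b A)
  show ?case
  proof (cases "A = {}")
    case True
    then show ?thesis by (intro exI[of _ "{}"]) auto
  next
    case False
    obtain T where T: "finite T" "card T = card A - 1" "\<forall>t\<in>T. g' t = 0 \<and> t < Max A"
      using insert by auto
    have lt: "Max A < b" using insert False by auto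
    have "g (Max A) = g b" using insert.prems False insert.hyps by auto
    moreover have "continuous_on {Max A..b} g"
      using der by (meson DERIV_continuous_on has_field_derivative_at_within)
    moreover have "g differentiable at x" for x
      using der real_differentiable_def by blast
    ultimately obtain z where z: "Max A < z" "z < b" "(g has_real_derivative 0) (at z)"
      using Rolle[OF lt, of g] by auto
    have g'z: "g' z = 0" using DERIV_unique[OF der z(3)] .
    have bm: "Max (insert b A) = b"
      using insert.hyps by (intro Max_eqI) auto
    have "z \<notin> T" using T z by auto
    have cA: "card A > 0" using False insert.hyps by (simp add: card_gt_0_iff)
    have "b \<notin> A" using insert.hyps by auto
    show ?thesis
      unfolding bm using T z g'z \<open>z \<notin> T\<close> cA \<open>b \<notin> A\<close> insert.hyps lt
      by (intro exI[of _ "insert z T"]) auto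
  qed
qed

text \<open>
  From the first power on, the normalization makes each one the derivative of the next. Power 0 is the indicator of
  the closed half line, so that \<open>truncated_power n (y - u)\<close> is the kernel of Taylor's remainder
  at \<open>y\<close> for every \<open>u\<close>, the case \<open>u = y\<close> included.
\<close>
definition truncated_power :: "nat \<Rightarrow> real \<Rightarrow> real" where
  "truncated_power n y = (if 0 \<le> y then y ^ n / fact n else 0)"

lemma truncated_power_has_derivative:
  "(truncated_power (Suc (Suc n)) has_real_derivative truncated_power (Suc n) y) (at y)"
proof -
  consider "y < 0" | "y > 0" | "y = 0" by linarith
  then show ?thesis
  proof cases
    case 1
    have "((\<lambda>_. 0) has_real_derivative truncated_power (Suc n) y) (at y)"
      using 1 by (auto simp: truncated_power_def)
    then show ?thesis
      by (rule has_field_derivative_transform_within_open[where S="{..<0}"])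
        (use 1 in \<open>auto simp: truncated_power_def\<close>)
  next
    case 2
    have "((\<lambda>y. y ^ Suc (Suc n) / fact (Suc (Suc n))) has_real_derivative
        (real (Suc (Suc n)) * y ^ Suc n) / fact (Suc (Suc n))) (at y)"
      by (rule DERIV_cdivide) (use DERIV_pow[of "Suc (Suc n)" y] in simp)
    also have "(real (Suc (Suc n)) * y ^ Suc n) / fact (Suc (Suc n)) = truncated_power (Suc n) y"
      using 2 by (simp add: truncated_power_def del: power_Suc of_nat_Suc)
    finally show ?thesis
      by (rule has_field_derivative_transform_within_open[where S="{0<..}"])
        (use 2 in \<open>auto simp: truncated_power_def\<close>)
  next
    case 3
    have le: "\<bar>truncated_power (Suc (Suc n)) h / h\<bar> \<le> \<bar>h\<bar> ^ Suc n" for h :: real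
    proof (cases "h > 0")
      case True
      have "h ^ Suc (Suc n) / fact (Suc (Suc n)) / h = h ^ Suc n / fact (Suc (Suc n))"
        using True by simp
      also have "\<dots> \<le> h ^ Suc n / 1"
        using True by (intro divide_left_mono) (auto simp del: fact_Suc)
      finally show ?thesis
        using True by (simp add: truncated_power_def del: power_Suc fact_Suc)
      next
      case False
      then have "truncated_power (Suc (Suc n)) h / h = 0"
        by (auto simp: truncated_power_def)
      then show ?thesis by (simp del: divide_eq_0_iff abs_divide)
    qed
    have "((\<lambda>h::real. \<bar>h\<bar> ^ Suc n) \<longlongrightarrow> \<bar>0\<bar> ^ Suc n) (at 0)"
      by (intro tendsto_intros)
    then have "((\<lambda>h::real. \<bar>h\<bar> ^ Suc n) \<longlongrightarrow> 0) (at 0)"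
      unfolding abs_zero power_0_Suc .
    then have "((\<lambda>h. truncated_power (Suc (Suc n)) h / h) \<longlongrightarrow> 0) (at 0)"
      by (rule Lim_null_comparison[rotated]) (use le in \<open>simp_all add: eventually_mono\<close>)
    then show ?thesis
      using 3 by (simp add: DERIV_def truncated_power_def)
  qed
qed

lemma truncated_power_measurable [measurable]: "truncated_power n \<in> borel_measurable borel"
  unfolding truncated_power_def by measurable

text \<open>
  Positive part minus parabola is strictly convex, hence has at most two zeros. The proof compares
  the middle point with the chord between the outer ones.
\<close>
lemma positive_part_meets_concave_parabola:
  fixes x y z :: real
  assumes "x < y" "y < z" "c < 0"
    and "truncated_power 1 (x - u) = a + b * x + c * x\<^sup>2"
    and "truncated_power 1 (y - u) = a + b * y + c * y\<^sup>2"
    and "truncated_power 1 (z - u) = a + b * z + c * z\<^sup>2"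
  shows False
proof -
  have tp: "truncated_power 1 t = max t 0" for t :: real by (simp add: truncated_power_def max_def)
  have "(z - x) * max (y - u) 0 \<le> (z - y) * max (x - u) 0 + (y - x) * max (z - u) 0"
  proof (cases "y \<ge> u")
    case True
    have "(z - y) * (x - u) \<le> (z - y) * max (x - u) 0" "(y - x) * (z - u) \<le> (y - x) * max (z - u) 0"
      using assms by (auto intro!: mult_left_mono)
    moreover have "(z - x) * (y - u) = (z - y) * (x - u) + (y - x) * (z - u)"
      by (simp add: algebra_simps)
    moreover have "max (y - u) 0 = y - u" using True by simp
    ultimately show ?thesis by simp
  qed (use assms in auto)
  then have "(z - x) * (a + b * y + c * y\<^sup>2) \<le>
      (z - y) * (a + b * x + c * x\<^sup>2) + (y - x) * (a + b * z + c * z\<^sup>2)"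
    unfolding assms(4-6)[unfolded tp] .
  moreover have "(z - x) * (a + b * y + c * y\<^sup>2) - (z - y) * (a + b * x + c * x\<^sup>2)
      - (y - x) * (a + b * z + c * z\<^sup>2) = - c * ((z - x) * (z - y) * (y - x))"
    by (simp add: algebra_simps power2_eq_square)
  moreover have "- c * ((z - x) * (z - y) * (y - x)) > 0"
    using assms by (intro mult_pos_pos) auto
  ultimately show False by linarith
qed

text \<open>
  Were the truncated power smooth, \<open>n + 1\<close> applications of Rolle's theorem to
  \<open>n + 2\<close> zeros would leave a zero of a nonnegative measure plus a positive constant. Since
  \<open>truncated_power 1\<close> has a kink, the descent stops there, where strict convexity takes over;
  for \<open>n = 0\<close> the difference is strictly increasing.
\<close>
lemma truncated_power_few_intersections:
  fixes R :: "real poly"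
  assumes "finite S" "card S = Suc (Suc n)" "degree R \<le> Suc n" "coeff R (Suc n) < 0"
    and "\<And>y. y \<in> S \<Longrightarrow> truncated_power n (y - u) = poly R y"
  shows False
  using assms
proof (induction n arbitrary: R S)
  case 0
  obtain x y where xy: "x \<in> S" "y \<in> S" "x < y"
  proof -
    obtain x y where "S = {x, y}" "x \<noteq> y" using 0(2) by (auto simp: numeral_2_eq_2[symmetric] card_2_iff)
    then show ?thesis using that by (cases "x < y") force+
  qed
  have pR: "poly R t = coeff R 0 + coeff R 1 * t" for t
  proof -
    have "R = (\<Sum>i\<le>1. monom (coeff R i) i)"
      using poly_as_sum_of_monoms'[of R 1] 0(3) by simp
    then have "poly R t = poly (\<Sum>i\<le>1. monom (coeff R i) i) t" by simp
    also have "\<dots> = coeff R 0 + coeff R 1 * t"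
      by (simp add: poly_sum poly_monom)
    finally show ?thesis .
  qed
  have "truncated_power 0 (x - u) \<le> truncated_power 0 (y - u)"
    using xy by (auto simp: truncated_power_def)
  moreover have "coeff R 1 * y < coeff R 1 * x" using 0(4) xy by simp
  ultimately show False using 0(5)[OF xy(1)] 0(5)[OF xy(2)] pR by simp
next
  case (Suc m)
  show ?case
  proof (cases m)
    case 0
    have c3: "card S = 3" using Suc 0 by simp
    obtain x y z where xyz: "x \<in> S" "y \<in> S" "z \<in> S" "x < y" "y < z"
    proof -
      have "S \<noteq> {}" using c3 by auto
      define l where "l = sorted_list_of_set S"
      have l: "length l = 3" "sorted l" "distinct l" "set l = S" using Suc.prems(1) c3 by (auto simp: l_def)
      then obtain a b c where "l = [a, b, c]" by (auto simp: numeral_3_eq_3 length_Suc_conv)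
      with l that show ?thesis by force
    qed
    have pR: "poly R t = coeff R 0 + coeff R 1 * t + coeff R 2 * t\<^sup>2" for t
    proof -
      have "R = (\<Sum>i\<le>2. monom (coeff R i) i)"
        using poly_as_sum_of_monoms'[of R 2] Suc.prems(3) 0 by simp
      then have "poly R t = poly (\<Sum>i\<le>2. monom (coeff R i) i) t" by simp
      also have "\<dots> = coeff R 0 + coeff R 1 * t + coeff R 2 * t\<^sup>2"
        by (simp add: poly_sum poly_monom numeral_2_eq_2)
      finally show ?thesis .
    qed
    show False
      using positive_part_meets_concave_parabola[OF xyz(4,5), of "coeff R 2" u "coeff R 0" "coeff R 1"]
        Suc.prems(4) Suc.prems(5)[OF xyz(1)] Suc.prems(5)[OF xyz(2)] Suc.prems(5)[OF xyz(3)] 0 pR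
      by (simp add: numeral_2_eq_2)
  next
    case (Suc j)
    define g where "g y = truncated_power (Suc m) (y - u) - poly R y" for y
    have "(g has_real_derivative truncated_power m (y - u) - poly (pderiv R) y) (at y)" for y
      unfolding g_def Suc
      by (intro DERIV_diff poly_DERIV DERIV_chain2[OF truncated_power_has_derivative, where g = "\<lambda>y. y - u" and Db = 1, simplified])
         (auto intro!: derivative_eq_intros)
    from Rolle_finite_zeros[OF Suc.prems(1) _ this] Suc.prems(5)
    obtain T where T: "finite T" "card T = card S - 1"
        "\<forall>t\<in>T. truncated_power m (t - u) - poly (pderiv R) t = 0"
      unfolding g_def by fastforce
    show False
    proof (rule Suc.IH[of T "pderiv R"])
      show "degree (pderiv R) \<le> Suc m" using Suc.prems(3) by (simp add: degree_pderiv)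
      show "coeff (pderiv R) (Suc m) < 0"
        using Suc.prems(4) by (simp add: coeff_pderiv mult_pos_neg)
    qed (use T Suc.prems in auto)
  qed
qed

section \<open>Lagrange interpolation and its Peano kernel\<close>

definition lagrange_basis :: "real set \<Rightarrow> real \<Rightarrow> real poly" where
  "lagrange_basis S s = (\<Prod>j\<in>S - {s}. smult (1 / (s - j)) [:- j, 1:])"

definition interpolant :: "real set \<Rightarrow> (real \<Rightarrow> real) \<Rightarrow> real poly" where
  "interpolant S \<phi> = (\<Sum>s\<in>S. smult (\<phi> s) (lagrange_basis S s))"

definition nodal_poly :: "real set \<Rightarrow> real poly" where
  "nodal_poly S = (\<Prod>s\<in>S. [:- s, 1:])"

lemma poly_interpolant: "poly (interpolant S \<phi>) x = (\<Sum>s\<in>S. \<phi> s * poly (lagrange_basis S s) x)"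
  by (simp add: interpolant_def poly_sum)

lemma degree_interpolant:
  assumes "finite S" "card S = Suc n"
  shows "degree (interpolant S \<phi>) \<le> n"
  unfolding interpolant_def
proof (rule degree_sum_le[OF assms(1)])
  fix s assume s: "s \<in> S"
  have "degree (lagrange_basis S s) \<le> sum (degree \<circ> (\<lambda>j. smult (1 / (s - j)) [:- j, 1:])) (S - {s})"
    unfolding lagrange_basis_def by (rule degree_prod_sum_le) (use assms in simp)
  also have "\<dots> \<le> (\<Sum>j\<in>S - {s}. 1)" by (rule sum_mono) (auto split: if_splits)
  also have "\<dots> = n" using assms s by simp
  finally show "degree (smult (\<phi> s) (lagrange_basis S s)) \<le> n"
    using degree_smult_le order_trans by blast
qed

lemma interpolant_at_node:
  assumes "finite S" "s \<in> S"
  shows "poly (interpolant S \<phi>) s = \<phi> s"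
proof -
  have "poly (lagrange_basis S t) s = (if t = s then 1 else 0)" if "t \<in> S" for t
  proof (cases "t = s")
    case False
    then have "s \<in> S - {t}" using assms by auto
    then show ?thesis using False assms by (force simp: lagrange_basis_def poly_prod)
  qed (auto simp: lagrange_basis_def poly_prod diff_divide_distrib[symmetric] intro!: prod.neutral)
  then have "poly (interpolant S \<phi>) s = (\<Sum>t\<in>S. if t = s then \<phi> s else 0)"
    unfolding poly_interpolant by (intro sum.cong) auto
  then show ?thesis using assms by simp
qed

lemma interpolant_poly:
  assumes "finite S" "card S = Suc n" "degree q \<le> n"
  shows "interpolant S (poly q) = q"
  by (rule poly_eqI_degree[where A = S])
    (use assms degree_interpolant[OF assms(1,2), of "poly q"] in \<open>auto simp: interpolant_at_node\<close>)

lemma degree_nodal_poly: "finite S \<Longrightarrow> degree (nodal_poly S) = card S"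
  unfolding nodal_poly_def by (subst degree_prod_eq_sum_degree) auto

lemma lead_coeff_nodal_poly: "lead_coeff (nodal_poly S) = 1"
  unfolding nodal_poly_def by (simp only: lead_coeff_prod) simp

lemma poly_nodal_poly: "poly (nodal_poly S) x = (\<Prod>s\<in>S. x - s)"
  by (simp add: nodal_poly_def poly_prod)

text \<open>
  The interpolation error at \<open>x\<close> of the function \<open>\<lambda>y. truncated_power n (y - u)\<close>. As a
  function of \<open>u\<close> it is \<open>poly (nodal_poly S) x\<close> times the B-spline with knots
  \<open>S\<close> and \<open>x\<close>, up to normalization.
\<close>
definition peano_kernel :: "nat \<Rightarrow> real set \<Rightarrow> real \<Rightarrow> real \<Rightarrow> real" where
  "peano_kernel n S x u =
     truncated_power n (x - u) - poly (interpolant S (\<lambda>y. truncated_power n (y - u))) x"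

text \<open>
  If the signs disagreed, adding a negative multiple of the nodal polynomial to the interpolant
  would produce a polynomial of degree \<open>n + 1\<close> that meets the truncated power at the nodes and
  at \<open>x\<close>, which is one intersection too many.
\<close>
lemma peano_kernel_sign:
  assumes S: "finite S" "card S = Suc n"
  shows "0 \<le> poly (nodal_poly S) x * peano_kernel n S x u"
proof (rule ccontr)
  assume neg: "\<not> ?thesis"
  define Q where "Q = interpolant S (\<lambda>y. truncated_power n (y - u))"
  define c where "c = peano_kernel n S x u / poly (nodal_poly S) x"
  define R where "R = Q + smult c (nodal_poly S)"
  have nz: "poly (nodal_poly S) x \<noteq> 0" using neg by auto
  then have x: "x \<notin> S" using S by (auto simp: poly_nodal_poly)
  have c: "c < 0" using neg by (auto simp: c_def divide_less_0_iff not_le mult_less_0_iff)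
  have dQ: "degree Q \<le> n" unfolding Q_def by (rule degree_interpolant[OF S])
  show False
  proof (rule truncated_power_few_intersections[of "insert x S" n R u])
    show "finite (insert x S)" "card (insert x S) = Suc (Suc n)" using S x by auto
    show "degree R \<le> Suc n"
      unfolding R_def using dQ S by (intro degree_add_le) (auto simp: degree_nodal_poly)
    have "coeff (nodal_poly S) (Suc n) = 1"
      using lead_coeff_nodal_poly[of S] degree_nodal_poly[of S] S by simp
    then show "coeff R (Suc n) < 0" using dQ c by (simp add: R_def coeff_eq_0)
    show "truncated_power n (y - u) = poly R y" if "y \<in> insert x S" for y
    proof (cases "y = x")
      case True
      then show ?thesis using nz by (simp add: R_def c_def Q_def peano_kernel_def)
    next
      case False
      then have "y \<in> S" using that by auto
      moreover have "poly (nodal_poly S) y = 0"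
        unfolding poly_nodal_poly using S \<open>y \<in> S\<close> by auto
      ultimately show ?thesis using S by (simp add: R_def Q_def interpolant_at_node)
    qed
  qed
qed

text \<open>
  To the right of all points the truncated powers vanish; to the left they coincide with a
  polynomial of degree \<open>n\<close>, which interpolation reproduces.
\<close>
lemma peano_kernel_outside:
  assumes S: "finite S" "card S = Suc n" and ab: "x \<in> {a..b}" "S \<subseteq> {a..b}" and u: "u \<notin> {a..b}"
  shows "peano_kernel n S x u = 0"
proof (cases "u > b")
  case True
  then have "truncated_power n (y - u) = 0" if "y \<in> {a..b}" for y
    using that by (auto simp: truncated_power_def)
  moreover from this have "poly (interpolant S (\<lambda>y. truncated_power n (y - u))) x = 0"
    unfolding poly_interpolant using ab by (intro sum.neutral) auto
  ultimately show ?thesis using ab by (simp add: peano_kernel_def)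
next
  case False
  then have "u < a" using u by auto
  define q where "q = smult (1 / fact n) ([:- u, 1:] ^ n)"
  have q: "truncated_power n (y - u) = poly q y" if "y \<in> {a..b}" for y
    using that \<open>u < a\<close> by (auto simp: truncated_power_def q_def)
  have "interpolant S (\<lambda>y. truncated_power n (y - u)) = interpolant S (poly q)"
    unfolding interpolant_def using q ab by (intro sum.cong) auto
  also have "\<dots> = q"
    by (rule interpolant_poly[OF S]) (auto simp: q_def degree_power_eq)
  finally show ?thesis using q ab by (simp add: peano_kernel_def)
qed

text \<open>
  Taylor's formula at a common base point turns the values of the function into a polynomial of
  degree \<open>n\<close>, reproduced by interpolation, plus remainders whose combination is the kernel.
  The integral is a Henstock--Kurzweil integral: a derivative that exists everywhere need not be
  Lebesgue integrable.
\<close>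
lemma peano_kernel_has_integral:
  fixes D :: "nat \<Rightarrow> real \<Rightarrow> real"
  assumes S: "finite S" "card S = Suc n"
    and D: "\<And>j t. j < Suc n \<Longrightarrow> (D j has_real_derivative D (Suc j) t) (at t)"
  shows "((\<lambda>u. D (Suc n) u * peano_kernel n S x u) has_integral D 0 x - poly (interpolant S (D 0)) x) UNIV"
proof -
  define a where "a = Min (insert x S)"
  define b where "b = Max (insert x S)"
  have ab: "x \<in> {a..b}" "S \<subseteq> {a..b}" using S by (auto simp: a_def b_def)
  define T where "T = (\<Sum>i\<le>n. smult (D i a / fact i) ([:- a, 1:] ^ i))"
  have dT: "degree T \<le> n"
    unfolding T_def
    by (rule degree_sum_le) (auto intro: order_trans[OF degree_smult_le] simp: degree_power_eq)
  have pT: "poly T y = (\<Sum>i<Suc n. ((y - a) ^ i / fact i) *\<^sub>R D i a)" for y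
    by (simp add: T_def poly_sum lessThan_Suc_atMost mult.commute algebra_simps)
  have node: "((\<lambda>u. D (Suc n) u * truncated_power n (y - u)) has_integral D 0 y - poly T y) {a..b}"
    if y: "y \<in> {a..b}" for y
  proof -
    have "((\<lambda>u. ((y - u) ^ (Suc n - 1) / fact (Suc n - 1)) *\<^sub>R D (Suc n) u) has_integral
        D 0 y - (\<Sum>i<Suc n. ((y - a) ^ i / fact i) *\<^sub>R D i a)) {a..y}"
      by (rule Taylor_has_integral)
        (use D y in \<open>auto intro: has_field_derivative_at_within
           simp: has_real_derivative_iff_has_vector_derivative[symmetric]\<close>)
    then have "((\<lambda>u. D (Suc n) u * truncated_power n (y - u)) has_integral D 0 y - poly T y) {a..y}"
      unfolding pT by (rule has_integral_eq[rotated]) (simp add: truncated_power_def)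
    then have "((\<lambda>u. if u \<in> {a..y} then D (Suc n) u * truncated_power n (y - u) else 0)
        has_integral D 0 y - poly T y) {a..b}"
      using y by (subst has_integral_restrict) auto
    then show ?thesis
      by (rule has_integral_eq[rotated]) (auto simp: truncated_power_def)
  qed
  have "((\<lambda>u. D (Suc n) u * truncated_power n (x - u)
        - (\<Sum>s\<in>S. D (Suc n) u * truncated_power n (s - u) * poly (lagrange_basis S s) x)) has_integral
       D 0 x - poly T x - (\<Sum>s\<in>S. (D 0 s - poly T s) * poly (lagrange_basis S s) x)) {a..b}"
    using ab S by (intro has_integral_diff has_integral_sum has_integral_mult_left node) auto
  also have "(\<Sum>s\<in>S. (D 0 s - poly T s) * poly (lagrange_basis S s) x)
     = poly (interpolant S (D 0)) x - poly (interpolant S (poly T)) x"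
    by (simp add: poly_interpolant left_diff_distrib sum_subtractf)
  also have "interpolant S (poly T) = T" by (rule interpolant_poly[OF S dT])
  finally have "((\<lambda>u. D (Suc n) u * peano_kernel n S x u) has_integral
      D 0 x - poly (interpolant S (D 0)) x) {a..b}"
    by (simp add: peano_kernel_def poly_interpolant right_diff_distrib sum_distrib_left mult.assoc)
  then show ?thesis
    by (rule has_integral_on_superset) (use peano_kernel_outside[OF S ab] in auto)
qed

lemma peano_kernel_measurable:
  assumes S: "finite S"
  shows "case_prod (peano_kernel n S) \<in> borel_measurable (borel \<Otimes>\<^sub>M borel)"
proof -
  have [measurable]: "poly q \<in> borel_measurable borel" for q :: "real poly"
    by (intro borel_measurable_continuous_onI continuous_intros)
  show ?thesis
    unfolding peano_kernel_def poly_interpolant by measurable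
qed

section \<open>Real roots of orthogonal polynomials\<close>

lemma poly_nonneg_if_no_root:
  fixes p :: "real poly"
  assumes "lead_coeff p > 0" "\<And>x. poly p x \<noteq> 0"
  shows "0 \<le> poly p x"
proof (rule ccontr)
  assume neg: "\<not> ?thesis"
  obtain b where b: "\<forall>y\<ge>b. poly p y \<ge> lead_coeff p" using poly_pinfty_gt_lc[OF assms(1)] by auto
  define y where "y = max b (x + 1)"
  have "poly p y > 0" using b assms(1) unfolding y_def by (meson max.cobounded1 order_less_le_trans)
  moreover have "x < y" by (simp add: y_def)
  ultimately show False using neg poly_IVT_pos[of x y p] assms(2) by force
qed

text \<open>
  The set \<open>S\<close> consists of the roots of odd multiplicity. Peeling off one root at a time, a
  root that is already in \<open>S\<close> leaves it again and contributes a square to the nonnegative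
  factor.
\<close>
lemma sign_change_factorization:
  fixes p :: "real poly"
  assumes "lead_coeff p = 1"
  shows "\<exists>S r. finite S \<and> p = nodal_poly S * r \<and> (\<forall>x. 0 \<le> poly r x)"
  using assms
proof (induction "degree p" arbitrary: p rule: less_induct)
  case less
  show ?case
  proof (cases "\<exists>a. poly p a = 0")
    case False
    then have "\<forall>x. 0 \<le> poly p x" using poly_nonneg_if_no_root less.prems by force
    then show ?thesis by (intro exI[of _ "{}"] exI[of _ p]) (simp add: nodal_poly_def)
  next
    case True
    then obtain a p' where p: "p = [:- a, 1:] * p'" by (auto simp: poly_eq_0_iff_dvd elim: dvdE)
    have nz: "p' \<noteq> 0" using less.prems p by auto
    have "lead_coeff p' = 1" using less.prems unfolding p lead_coeff_mult by simp
    moreover have "degree p' < degree p" unfolding p using nz by (subst degree_mult_eq) auto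
    ultimately obtain S r where S: "finite S" "p' = nodal_poly S * r" "\<forall>x. 0 \<le> poly r x"
      using less.hyps by blast
    show ?thesis
    proof (cases "a \<in> S")
      case True
      then have "nodal_poly S = [:- a, 1:] * nodal_poly (S - {a})"
        unfolding nodal_poly_def using S by (simp only: prod.remove)
      then have "p = nodal_poly (S - {a}) * ([:- a, 1:]\<^sup>2 * r)"
        unfolding p S(2) power2_eq_square by (simp only: ac_simps)
      moreover have "\<forall>x. 0 \<le> poly ([:- a, 1:]\<^sup>2 * r) x" using S by simp
      ultimately show ?thesis using S by blast
    next
      case False
      then have "p = nodal_poly (insert a S) * r"
        unfolding p S(2) nodal_poly_def prod.insert[OF S(1) False] by (simp only: mult.assoc)
      then show ?thesis using S by blast
    qed
  qed
qed

section \<open>Mixtures of densities and Henstock--Kurzweil integrals\<close>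

text \<open>
  One finite part makes a Henstock--Kurzweil integral absolute: subtracting it from the integral of
  the finite part shows that the other part, being nonnegative, has a finite integral too.
\<close>
lemma signed_has_integral_nn_integral:
  fixes f h :: "real \<Rightarrow> real"
  assumes [measurable]: "f \<in> borel_measurable borel" "h \<in> borel_measurable borel"
    and h: "\<And>u. 0 \<le> h u" and I: "((\<lambda>u. f u * h u) has_integral I) UNIV"
    and fin: "(\<integral>\<^sup>+ u. ennreal (f u) * ennreal (h u) \<partial>lborel) < \<infinity>" (is "?A < _")
  shows "(\<integral>\<^sup>+ u. ennreal (- f u) * ennreal (h u) \<partial>lborel) = ennreal (enn2real ?A - I)"
    and "I \<le> enn2real ?A"
proof -
  have mult: "ennreal (g u) * ennreal (h u) = ennreal (max 0 (g u) * h u)" for g :: "real \<Rightarrow> real" and u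
  proof -
    have "ennreal (g u) = ennreal (max 0 (g u))" by (cases "0 \<le> g u") (auto simp: ennreal_neg)
    then show ?thesis using h[of u] by (simp only: ennreal_mult)
  qed
  have fin': "(\<integral>\<^sup>+ u. ennreal (max 0 (f u) * h u) \<partial>lborel) < \<infinity>"
    using fin unfolding mult .
  have int: "integrable lborel (\<lambda>u. max 0 (f u) * h u)"
    by (rule integrableI_nonneg) (use fin' h in auto)
  have A: "integral\<^sup>L lborel (\<lambda>u. max 0 (f u) * h u) = enn2real ?A"
    unfolding mult by (rule integral_eq_nn_integral) (use h in auto)
  have "((\<lambda>u. max 0 (f u) * h u - f u * h u) has_integral enn2real ?A - I) UNIV"
    using has_integral_diff[OF has_integral_integral_lborel[OF int] I] unfolding A .
  also have "(\<lambda>u. max 0 (f u) * h u - f u * h u) = (\<lambda>u. max 0 (- f u) * h u)"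
    by (auto simp: max_def algebra_simps)
  finally have *: "((\<lambda>u. max 0 (- f u) * h u) has_integral enn2real ?A - I) UNIV" .
  show "(\<integral>\<^sup>+ u. ennreal (- f u) * ennreal (h u) \<partial>lborel) = ennreal (enn2real ?A - I)"
    unfolding mult[of "\<lambda>u. - f u"]
    by (rule nn_integral_has_integral_lborel[OF _ _ *]) (use h in auto)
  show "I \<le> enn2real ?A"
    using has_integral_nonneg[OF *] h by simp
qed

context
  fixes N :: "'b measure" and h :: "'b \<Rightarrow> real \<Rightarrow> real"
  assumes prob: "prob_space N"
    and h_meas [measurable]: "case_prod h \<in> borel_measurable (N \<Otimes>\<^sub>M borel)"
    and h_nonneg: "\<And>w u. 0 \<le> h w u"
begin

text \<open>
  The marginal law of \<open>u\<close> when the pair of \<open>w\<close> and \<open>u\<close> has density \<open>h\<close> with respect to the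
  product of \<open>N\<close> and Lebesgue measure.
\<close>
definition mixture :: "real measure" where
  "mixture = density lborel (\<lambda>u. \<integral>\<^sup>+ w. ennreal (h w u) \<partial>N)"

lemma nn_integral_mixture:
  assumes [measurable]: "\<phi> \<in> borel_measurable borel"
  shows "(\<integral>\<^sup>+ u. \<phi> u \<partial>mixture) = (\<integral>\<^sup>+ w. (\<integral>\<^sup>+ u. \<phi> u * ennreal (h w u) \<partial>lborel) \<partial>N)"
proof -
  interpret prob_space N by (rule prob)
  interpret pair_sigma_finite N "lborel :: real measure" ..
  have "(\<integral>\<^sup>+ u. \<phi> u \<partial>mixture) = (\<integral>\<^sup>+ u. (\<integral>\<^sup>+ w. ennreal (h w u) \<partial>N) * \<phi> u \<partial>lborel)"
    unfolding mixture_def by (subst nn_integral_density) auto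
  also have "\<dots> = (\<integral>\<^sup>+ u. (\<integral>\<^sup>+ w. \<phi> u * ennreal (h w u) \<partial>N) \<partial>lborel)"
    by (intro nn_integral_cong) (subst nn_integral_cmult, auto simp: mult.commute)
  also have "\<dots> = (\<integral>\<^sup>+ w. (\<integral>\<^sup>+ u. \<phi> u * ennreal (h w u) \<partial>lborel) \<partial>N)"
    by (rule Fubini') measurable
  finally show ?thesis .
qed

lemma sets_mixture [measurable_cong, simp]: "sets mixture = sets borel"
  by (simp add: mixture_def)

text \<open>
  The point is that \<open>f\<close> is integrated against \<open>h w\<close> in the Henstock--Kurzweil sense only. By
  Tonelli's theorem the positive part of \<open>f\<close> is integrable against almost every \<open>h w\<close>; then so
  is the negative part, and its integral exceeds that of the positive part by \<open>- D w\<close>, whose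
  expectation is finite.
\<close>
lemma mixture_expectation_pos:
  fixes f :: "real \<Rightarrow> real"
  assumes f [measurable]: "f \<in> borel_measurable borel"
    and D: "integrable N D" "\<And>w. w \<in> space N \<Longrightarrow> ((\<lambda>u. f u * h w u) has_integral D w) UNIV"
    and fin: "(\<integral>\<^sup>+ u. ennreal (f u) \<partial>mixture) < \<infinity>"
  shows "integrable mixture f \<and> integral\<^sup>L mixture f = integral\<^sup>L N D"
proof -
  interpret prob_space N by (rule prob)
  define A where "A w = (\<integral>\<^sup>+ u. ennreal (f u) * ennreal (h w u) \<partial>lborel)" for w
  define B where "B w = (\<integral>\<^sup>+ u. ennreal (- f u) * ennreal (h w u) \<partial>lborel)" for w
  have [measurable]: "A \<in> borel_measurable N" "B \<in> borel_measurable N"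
    unfolding A_def B_def by measurable
  have [measurable]: "D \<in> borel_measurable N" using D by auto
  have fA: "(\<integral>\<^sup>+ u. ennreal (f u) \<partial>mixture) = (\<integral>\<^sup>+ w. A w \<partial>N)"
    and fB: "(\<integral>\<^sup>+ u. ennreal (- f u) \<partial>mixture) = (\<integral>\<^sup>+ w. B w \<partial>N)"
    unfolding A_def B_def by (auto intro: nn_integral_mixture)
  have "AE w in N. A w \<noteq> \<infinity>"
    using fin unfolding fA by (intro nn_integral_PInf_AE) auto
  then have AB: "AE w in N. A w = ennreal (enn2real (A w)) \<and>
      B w = ennreal (enn2real (A w) - D w) \<and> D w \<le> enn2real (A w)"
  proof (rule AE_mp, intro AE_I2 impI)
    fix w assume w: "w \<in> space N" "A w \<noteq> \<infinity>"
    then have "A w < \<infinity>" by (simp add: less_top)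
    moreover have "h w \<in> borel_measurable borel" using w by measurable
    ultimately show "A w = ennreal (enn2real (A w)) \<and>
      B w = ennreal (enn2real (A w) - D w) \<and> D w \<le> enn2real (A w)"
      using signed_has_integral_nn_integral[of f "h w" "D w"] D(2)[OF w(1)] h_nonneg
      by (auto simp: A_def B_def)
  qed
  have intA: "integrable N (\<lambda>w. enn2real (A w))"
  proof (rule integrableI_nonneg)
    have "(\<integral>\<^sup>+ w. ennreal (enn2real (A w)) \<partial>N) = (\<integral>\<^sup>+ w. A w \<partial>N)"
      by (rule nn_integral_cong_AE) (use AB in auto)
    then show "(\<integral>\<^sup>+ w. ennreal (enn2real (A w)) \<partial>N) < \<infinity>" using fin fA by simp
  qed auto
  have nA: "(\<integral>\<^sup>+ w. A w \<partial>N) = ennreal (\<integral>w. enn2real (A w) \<partial>N)"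
  proof -
    have "(\<integral>\<^sup>+ w. A w \<partial>N) = (\<integral>\<^sup>+ w. ennreal (enn2real (A w)) \<partial>N)"
      by (rule nn_integral_cong_AE) (use AB in auto)
    also have "\<dots> = ennreal (\<integral>w. enn2real (A w) \<partial>N)"
      by (rule nn_integral_eq_integral[OF intA]) simp
    finally show ?thesis .
  qed
  have nB: "(\<integral>\<^sup>+ w. B w \<partial>N) = ennreal (\<integral>w. enn2real (A w) - D w \<partial>N)"
  proof -
    have "(\<integral>\<^sup>+ w. B w \<partial>N) = (\<integral>\<^sup>+ w. ennreal (enn2real (A w) - D w) \<partial>N)"
      by (rule nn_integral_cong_AE) (use AB in auto)
    also have "\<dots> = ennreal (\<integral>w. enn2real (A w) - D w \<partial>N)"
      by (rule nn_integral_eq_integral) (use AB intA D in auto)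
    finally show ?thesis .
  qed
  have "integrable mixture f"
    unfolding real_integrable_def fA fB using nA nB by simp
  moreover from this have "integral\<^sup>L mixture f = enn2real (\<integral>\<^sup>+ w. A w \<partial>N) - enn2real (\<integral>\<^sup>+ w. B w \<partial>N)"
    by (simp add: real_lebesgue_integral_def fA fB)
  moreover have "(\<integral>w. enn2real (A w) \<partial>N) \<ge> 0" by (rule integral_nonneg_AE) auto
  moreover have "(\<integral>w. enn2real (A w) - D w \<partial>N) \<ge> 0" by (rule integral_nonneg_AE) (use AB in auto)
  ultimately show ?thesis using nA nB intA D by simp
qed

lemma mixture_expectation:
  fixes f :: "real \<Rightarrow> real"
  assumes f: "f \<in> borel_measurable borel"
    and D: "integrable N D" "\<And>w. w \<in> space N \<Longrightarrow> ((\<lambda>u. f u * h w u) has_integral D w) UNIV"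
    and fin: "has_expectation mixture f"
  shows "integrable mixture f \<and> integral\<^sup>L mixture f = integral\<^sup>L N D"
proof (cases "(\<integral>\<^sup>+ u. ennreal (f u) \<partial>mixture) < \<infinity>")
  case True
  then show ?thesis using mixture_expectation_pos[OF f D] by blast
next
  case False
  then have "(\<integral>\<^sup>+ u. ennreal (- f u) \<partial>mixture) < \<infinity>" using fin by (auto simp: has_expectation_def)
  moreover have "((\<lambda>u. - f u * h w u) has_integral - D w) UNIV" if "w \<in> space N" for w
    using has_integral_neg[OF D(2)[OF that]] by simp
  ultimately have "integrable mixture (\<lambda>u. - f u) \<and> integral\<^sup>L mixture (\<lambda>u. - f u) = integral\<^sup>L N (\<lambda>w. - D w)"
    using f D by (intro mixture_expectation_pos) auto
  then show ?thesis by simp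
qed

end

section \<open>Moments and orthogonality\<close>

lemma poly_moment:
  fixes q :: "real poly"
  assumes mom: "\<And>j. j \<le> d \<Longrightarrow> integrable N (\<lambda>w. X w ^ j)" and d: "degree q \<le> d"
  shows "integrable N (\<lambda>w. poly q (X w))"
    and "(LINT w|N. poly q (X w)) = (\<Sum>j\<le>d. coeff q j * (LINT w|N. X w ^ j))"
proof -
  have q: "poly q x = (\<Sum>j\<le>d. coeff q j * x ^ j)" for x
    by (subst poly_as_sum_of_monoms'[OF d, symmetric]) (simp add: poly_sum poly_monom)
  show "integrable N (\<lambda>w. poly q (X w))"
    unfolding q using mom by (intro Bochner_Integration.integrable_sum) auto
  show "(LINT w|N. poly q (X w)) = (\<Sum>j\<le>d. coeff q j * (LINT w|N. X w ^ j))"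
    unfolding q using mom by (subst Bochner_Integration.integral_sum) auto
qed

text \<open>
  The monic \<open>P j\<close> with \<open>j < k\<close> span the polynomials of degree below \<open>k\<close>: the induction removes
  one leading coefficient at a time.
\<close>
lemma orthogonal_to_lower_degree:
  fixes P :: "nat \<Rightarrow> real poly"
  assumes mom: "\<And>j. j \<le> 2 * k \<Longrightarrow> integrable M (\<lambda>w. Z w ^ j)"
    and P: "\<And>j. j \<le> k \<Longrightarrow> lead_coeff (P j) = 1" "\<And>j. j \<le> k \<Longrightarrow> degree (P j) = j"
    and orth: "\<And>j. j < k \<Longrightarrow> (LINT w|M. poly (P k * P j) (Z w)) = 0"
    and q: "degree q < k"
  shows "(LINT w|M. poly (P k * q) (Z w)) = 0"
proof -
  have int: "integrable M (\<lambda>w. poly (P k * q) (Z w))" if "degree q \<le> k" for q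
    by (rule poly_moment[where d = "2 * k"])
      (use mom P(2)[of k] that degree_mult_le[of "P k" q] in auto)
  have "(LINT w|M. poly (P k * q) (Z w)) = 0" if "n \<le> k" "\<forall>i\<ge>n. coeff q i = 0" for n q
    using that
  proof (induction n arbitrary: q)
    case 0
    then have "q = 0" by (intro poly_eqI) simp
    then show ?case by simp
  next
    case (Suc n)
    define q' where "q' = q - smult (coeff q n) (P n)"
    have "coeff q' i = 0" if "n \<le> i" for i
    proof (cases "i = n")
      case True
      then show ?thesis using P[of n] Suc.prems by (simp add: q'_def)
    next
      case False
      then show ?thesis using P(2)[of n] Suc.prems that by (simp add: q'_def coeff_eq_0)
    qed
    then have q': "(LINT w|M. poly (P k * q') (Z w)) = 0" using Suc by auto
    have "degree q' \<le> k"
      using \<open>\<And>i. n \<le> i \<Longrightarrow> coeff q' i = 0\<close> Suc.prems by (intro degree_le) auto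
    moreover have "P k * q = P k * q' + smult (coeff q n) (P k * P n)"
      by (simp add: q'_def algebra_simps)
    ultimately have "(LINT w|M. poly (P k * q) (Z w)) =
        (LINT w|M. poly (P k * q') (Z w)) + coeff q n * (LINT w|M. poly (P k * P n) (Z w))"
      using int[of q'] int[of "P n"] P(2)[of n] Suc.prems by (simp del: poly_mult)
    then show ?case using q' orth Suc.prems by simp
  qed
  from this[of k q] q show ?thesis by (simp add: coeff_eq_0)
qed

text \<open>
  With fewer than \<open>degree p\<close> sign changes, \<open>p\<close> would be orthogonal to the nodal polynomial of
  its sign changes; but the product of the two is nonnegative, so \<open>p\<close> would vanish almost surely.
\<close>
lemma orthogonal_poly_splits:
  fixes p :: "real poly"
  assumes mom: "\<And>j. j \<le> 2 * degree p \<Longrightarrow> integrable N (\<lambda>w. X w ^ j)"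
    and monic: "lead_coeff p = 1"
    and orth: "\<And>q. degree q < degree p \<Longrightarrow> (LINT w|N. poly (p * q) (X w)) = 0"
    and pos: "(LINT w|N. poly (p * p) (X w)) > 0"
  shows "\<exists>S. finite S \<and> card S = degree p \<and> p = nodal_poly S"
proof -
  obtain S r where S: "finite S" "p = nodal_poly S * r" "\<forall>x. 0 \<le> poly r x"
    using sign_change_factorization[OF monic] by auto
  let ?q = "nodal_poly S"
  have nz: "?q \<noteq> 0" "r \<noteq> 0" using monic S(2) by auto
  have deg: "degree p = card S + degree r"
    unfolding S(2) degree_mult_eq[OF nz] degree_nodal_poly[OF S(1)] ..
  have r1: "lead_coeff r = 1"
    using monic unfolding S(2) lead_coeff_mult lead_coeff_nodal_poly by simp
  have "degree r = 0"
  proof (rule ccontr)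
    assume "degree r \<noteq> 0"
    then have lt: "degree ?q < degree p" using deg degree_nodal_poly[OF S(1)] by simp
    have "integrable N (\<lambda>w. poly (p * ?q) (X w))"
      by (rule poly_moment[OF mom]) (use lt degree_mult_le[of p ?q] in auto)
    moreover have nn: "0 \<le> poly (p * ?q) x" for x
      using S(3) by (simp add: S(2) mult.assoc mult.left_commute[of _ "poly r x"])
    ultimately have "AE w in N. poly (p * ?q) (X w) = 0"
      using orth[OF lt] integral_nonneg_eq_0_iff_AE[of N "\<lambda>w. poly (p * ?q) (X w)"] by simp
    then have "AE w in N. poly (p * p) (X w) = 0"
      by eventually_elim (auto simp: S(2))
    then have "(LINT w|N. poly (p * p) (X w)) = 0"
      by (rule integral_eq_zero_AE)
    then show False using pos by simp
  qed
  moreover from this obtain c where "r = [:c:]" by (rule degree_eq_zeroE)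
  ultimately have "r = 1" using r1 by (simp add: one_pCons)
  then show ?thesis using S deg \<open>degree r = 0\<close> by auto
qed

section \<open>The transformed distribution\<close>

text \<open>
  The kernel of the \<open>k\<close>-th derivative in \<open>p x * (F x - Q x)\<close>, with \<open>Q\<close> the interpolant of
  \<open>F\<close> at the roots of \<open>p\<close>, is nonnegative, and \<open>Q\<close> disappears on taking expectations, because
  \<open>p\<close> is orthogonal to it. Averaging the kernel over \<open>X\<close> thus gives the density of the
  transformed law, up to the factor \<open>\<alpha>\<close>.
\<close>
lemma stein_transform_exists:
  fixes X :: "'b \<Rightarrow> real"
  assumes prob: "prob_space N" and X [measurable]: "X \<in> borel_measurable N"
    and S: "finite S" "card S = Suc n"
    and p: "p = nodal_poly S"
    and mom: "\<And>j. j \<le> 2 * Suc n \<Longrightarrow> integrable N (\<lambda>w. X w ^ j)"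
    and orth: "\<And>q. degree q < Suc n \<Longrightarrow> (LINT w|N. poly (p * q) (X w)) = 0"
    and \<alpha>: "\<alpha> = (LINT w|N. X w ^ Suc n * poly p (X w)) / fact (Suc n)" "\<alpha> > 0"
  shows "\<exists>N'. prob_space N' \<and> sets N' = sets borel \<and>
           (\<forall>F\<in>diff_class (Suc n) (poly p) N X. has_expectation N' ((deriv ^^ Suc n) F) \<longrightarrow>
              integrable N' ((deriv ^^ Suc n) F) \<and>
              (LINT w|N. poly p (X w) * F (X w)) = \<alpha> * integral\<^sup>L N' ((deriv ^^ Suc n) F))"
proof -
  define h where "h w u = poly p (X w) * peano_kernel n S (X w) u / \<alpha>" for w u
  have [measurable]: "poly q \<in> borel_measurable borel" for q :: "real poly"
    by (intro borel_measurable_continuous_onI continuous_intros)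
  note [measurable] = peano_kernel_measurable[OF S(1), of n]
  have h_meas: "case_prod h \<in> borel_measurable (N \<Otimes>\<^sub>M borel)"
    unfolding h_def by measurable
  have h_nonneg: "0 \<le> h w u" for w u
    using peano_kernel_sign[OF S] \<alpha>(2) unfolding h_def p by (intro divide_nonneg_pos) auto
  have h_integral: "((\<lambda>u. D (Suc n) u * h w u) has_integral
      poly p (X w) * (D 0 (X w) - poly (interpolant S (D 0)) (X w)) / \<alpha>) UNIV"
    if "\<And>j t. j < Suc n \<Longrightarrow> (D j has_real_derivative D (Suc j) t) (at t)" for D w
    using has_integral_mult_right[OF peano_kernel_has_integral[OF S, of D "X w"], of "poly p (X w) / \<alpha>"] that
    by (simp add: h_def mult_ac)
  have dp: "degree p = Suc n" using degree_nodal_poly[OF S(1)] S(2) p by simp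
  have int_lower: "integrable N (\<lambda>w. poly p (X w) * poly q (X w))"
      "(LINT w|N. poly p (X w) * poly q (X w)) = 0" if "degree q \<le> n" for q
  proof -
    have d: "degree (p * q) \<le> 2 * Suc n"
      by (rule order_trans[OF degree_mult_le]) (use that dp in simp)
    have "integrable N (\<lambda>w. poly (p * q) (X w))" by (rule poly_moment(1)[OF mom d])
    then show "integrable N (\<lambda>w. poly p (X w) * poly q (X w))" by simp
    have "degree q < Suc n" using that by simp
    then show "(LINT w|N. poly p (X w) * poly q (X w)) = 0" using orth by simp
  qed
  let ?N' = "mixture N h"
  note mix = prob h_meas h_nonneg
  have "prob_space ?N'"
  proof (rule prob_spaceI)
    \<comment> \<open>The total mass is the identity for the function \<open>t ^ Suc n / fact (Suc n)\<close>, whose top derivative is 1.\<close>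
    define D where "D j t = t ^ (Suc n - j) / fact (Suc n - j)" for j and t :: real
    define Dw where "Dw w = poly p (X w) * (D 0 (X w) - poly (interpolant S (D 0)) (X w)) / \<alpha>" for w
    have D: "(D j has_real_derivative D (Suc j) t) (at t)" if "j < Suc n" for j t
    proof -
      define i where "i = n - j"
      have i: "Suc n - j = Suc i" "Suc n - Suc j = i" using that by (auto simp: i_def)
      have "((\<lambda>t. t ^ Suc i / fact (Suc i)) has_real_derivative
          (real (Suc i) * t ^ i) / fact (Suc i)) (at t)"
        by (rule DERIV_cdivide) (use DERIV_pow[of "Suc i" t] in simp)
      then show ?thesis unfolding D_def i by (simp del: power_Suc of_nat_Suc)
    qed
    have Dw: "((\<lambda>u. h w u) has_integral Dw w) UNIV" for w
      using h_integral[of D w, OF D] by (simp add: D_def Dw_def)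
    have Dw_nonneg: "0 \<le> Dw w" for w using has_integral_nonneg[OF Dw] h_nonneg by auto
    have Dw_eq: "Dw w = (X w ^ Suc n * poly p (X w)) / fact (Suc n) / \<alpha>
        - poly p (X w) * poly (interpolant S (D 0)) (X w) / \<alpha>" for w
      by (simp add: Dw_def D_def right_diff_distrib diff_divide_distrib mult.commute del: power_Suc fact_Suc)
    have "integrable N (\<lambda>w. poly (monom 1 (Suc n) * p) (X w))"
      by (rule poly_moment[OF mom])
        (use degree_mult_le[of "monom 1 (Suc n)" p] in \<open>auto simp: dp degree_monom_eq\<close>)
    then have int1: "integrable N (\<lambda>w. X w ^ Suc n * poly p (X w))" by (simp add: poly_monom del: power_Suc)
    have int2: "degree (interpolant S (D 0)) \<le> n" by (rule degree_interpolant[OF S])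
    have "integrable N Dw" unfolding Dw_eq using int1 int_lower[OF int2] by auto
    moreover have "integral\<^sup>L N Dw = 1"
    proof -
      have "(LINT w|N. X w ^ Suc n * poly p (X w)) = fact (Suc n) * \<alpha>"
        unfolding \<alpha>(1) by (simp del: power_Suc fact_Suc)
      then show ?thesis
        unfolding Dw_eq using int1 int_lower[OF int2] \<alpha>(2) by (simp del: power_Suc fact_Suc)
    qed
    ultimately have "(\<integral>\<^sup>+ w. ennreal (Dw w) \<partial>N) = 1"
      using nn_integral_eq_integral[of N Dw] Dw_nonneg by simp
    moreover have "(\<integral>\<^sup>+ u. ennreal (h w u) \<partial>lborel) = ennreal (Dw w)" if "w \<in> space N" for w
      by (rule nn_integral_has_integral_lborel[OF _ h_nonneg Dw])
        (use measurable_compose_Pair1[OF that h_meas] in simp)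
    moreover have "emeasure ?N' (space ?N') = (\<integral>\<^sup>+ u. 1 \<partial>?N')" by simp
    ultimately show "emeasure ?N' (space ?N') = 1"
      by (subst (asm) nn_integral_mixture[OF mix]) (auto cong: nn_integral_cong)
  qed
  moreover have "sets ?N' = sets borel" by (rule sets_mixture[OF mix])
  moreover have "integrable ?N' ((deriv ^^ Suc n) F) \<and>
      (LINT w|N. poly p (X w) * F (X w)) = \<alpha> * integral\<^sup>L ?N' ((deriv ^^ Suc n) F)"
    if F: "F \<in> diff_class (Suc n) (poly p) N X" and ex: "has_expectation ?N' ((deriv ^^ Suc n) F)" for F
  proof -
    define Dw where "Dw w = poly p (X w) * (F (X w) - poly (interpolant S F) (X w)) / \<alpha>" for w
    have meas: "(deriv ^^ Suc n) F \<in> borel_measurable borel"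
      and pF: "integrable N (\<lambda>w. poly p (X w) * F (X w))"
      using F by (auto simp: diff_class_def)
    have der: "((deriv ^^ j) F has_real_derivative (deriv ^^ Suc j) F t) (at t)" if "j < Suc n" for j t
      using F that by (simp add: diff_class_def DERIV_deriv_iff_real_differentiable)
    have Dw: "((\<lambda>u. (deriv ^^ Suc n) F u * h w u) has_integral Dw w) UNIV" for w
      using h_integral[of "\<lambda>j. (deriv ^^ j) F" w, OF der] by (simp add: Dw_def)
    have Dw_eq: "Dw w = poly p (X w) * F (X w) / \<alpha> - poly p (X w) * poly (interpolant S F) (X w) / \<alpha>" for w
      by (simp add: Dw_def right_diff_distrib diff_divide_distrib)
    note low = int_lower[OF degree_interpolant[OF S], of F]
    have iDw: "integrable N Dw" unfolding Dw_eq using pF low by auto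
    have "integral\<^sup>L N Dw = (LINT w|N. poly p (X w) * F (X w)) / \<alpha>"
      unfolding Dw_eq using pF low by simp
    with mixture_expectation[OF mix meas iDw Dw ex] \<alpha>(2) show ?thesis by simp
  qed
  ultimately show ?thesis by blast
qed

theorem corollary3p1:
  fixes m :: nat
    and I :: "real set"
    and L :: "real \<Rightarrow> real measure"
    and M :: "real \<Rightarrow> 'a measure"
    and Z :: "real \<Rightarrow> 'a \<Rightarrow> real"
    and P :: "real \<Rightarrow> nat \<Rightarrow> real poly"
    and N :: "'b measure"
  assumes "\<And>l. l \<in> I \<Longrightarrow> real_distribution (L l)"
    and "\<And>l. l \<in> I \<Longrightarrow> prob_space (M l)"
    and "\<And>l. l \<in> I \<Longrightarrow> Z l \<in> borel_measurable (M l)"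
    and "\<And>l. l \<in> I \<Longrightarrow> distr (M l) borel (Z l) = L l"
    and "\<And>l. l \<in> I \<Longrightarrow> integrable (M l) (\<lambda>w. Z l w ^ (2 * m))"
    and "\<And>l k. l \<in> I \<Longrightarrow> k \<le> m \<Longrightarrow> lead_coeff (P l k) = 1"
    and "\<And>l k. l \<in> I \<Longrightarrow> k \<le> m \<Longrightarrow> degree (P l k) = k"
    and "\<And>l. l \<in> I \<Longrightarrow> orthogonal_upto m (P l) (M l) (Z l)"
    and "\<And>l k. l \<in> I \<Longrightarrow> k \<le> m \<Longrightarrow> (LINT w|M l. (poly (P l k) (Z l w))\<^sup>2) > 0"
    and "prob_space N"
  shows "\<forall>l\<in>I. \<forall>k\<le>m. \<forall>X\<in>moment_class k (M l) (Z l) N.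
           \<exists>(N' :: real measure) Y. prob_space N' \<and> Y \<in> borel_measurable N' \<and>
             (\<forall>F\<in>diff_class k (poly (P l k)) N X.
                has_expectation N' (\<lambda>w. (deriv ^^ k) F (Y w)) \<longrightarrow>
                integrable N' (\<lambda>w. (deriv ^^ k) F (Y w)) \<and>
                (LINT w|N. poly (P l k) (X w) * F (X w)) =
                  alpha k (P l) (M l) (Z l) * (LINT w|N'. (deriv ^^ k) F (Y w)))"
proof (intro ballI allI impI)
  fix l k X
  assume l: "l \<in> I" and k: "k \<le> m" and X: "X \<in> moment_class k (M l) (Z l) N"
  interpret Ml: prob_space "M l" using assms(2) l .
  interpret N: prob_space N by (rule assms(10))
  define p where "p = P l k"
  have monic: "lead_coeff p = 1" and deg: "degree p = k" using assms(6,7) l k by (auto simp: p_def)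
  have Xm [measurable]: "X \<in> borel_measurable N" using X by (simp add: moment_class_def)
  have momX: "integrable N (\<lambda>w. X w ^ j)" and momZ: "integrable (M l) (\<lambda>w. Z l w ^ j)"
    and momEq: "(LINT w|N. X w ^ j) = (LINT w|M l. Z l w ^ j)" if "j \<le> 2 * k" for j
    using X that by (auto simp: moment_class_def)
  \<comment> \<open>Orthogonality, second moment and \<open>\<alpha>\<close> only involve moments of order at most \<open>2 * k\<close>.\<close>
  have transfer: "(LINT w|N. poly q (X w)) = (LINT w|M l. poly q (Z l w))" if "degree q \<le> 2 * k" for q
    using poly_moment(2)[OF momX that] poly_moment(2)[OF momZ that] momEq by simp
  have orthZ: "(LINT w|M l. poly (p * q) (Z l w)) = 0" if "degree q < k" for q
    unfolding p_def
  proof (rule orthogonal_to_lower_degree[OF momZ _ _ _ that])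
    show "(LINT w|M l. poly (P l k * P l j) (Z l w)) = 0" if "j < k" for j
      using assms(8)[OF l] that k by (simp add: orthogonal_upto_def)
  qed (use assms(6,7) l k in auto)
  have orthX: "(LINT w|N. poly (p * q) (X w)) = 0" if "degree q < k" for q
    using orthZ[OF that] transfer[of "p * q"] that degree_mult_le[of p q] deg by simp
  have sq: "(LINT w|N. poly (p * p) (X w)) > 0"
    using assms(9)[OF l k] transfer[of "p * p"] degree_mult_le[of p p] deg
    by (simp add: p_def power2_eq_square)
  have deg_monom: "degree (monom 1 k * p) \<le> 2 * k"
    using degree_mult_le[of "monom 1 k" p] deg by (simp add: degree_monom_eq)
  have alpha_X: "alpha k (P l) (M l) (Z l) = (LINT w|N. X w ^ k * poly p (X w)) / fact k"
    using transfer[OF deg_monom] by (simp add: alpha_def p_def poly_monom)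
  show "\<exists>(N' :: real measure) Y. prob_space N' \<and> Y \<in> borel_measurable N' \<and>
             (\<forall>F\<in>diff_class k (poly (P l k)) N X.
                has_expectation N' (\<lambda>w. (deriv ^^ k) F (Y w)) \<longrightarrow>
                integrable N' (\<lambda>w. (deriv ^^ k) F (Y w)) \<and>
                (LINT w|N. poly (P l k) (X w) * F (X w)) =
                  alpha k (P l) (M l) (Z l) * (LINT w|N'. (deriv ^^ k) F (Y w)))"
  proof (cases k)
    \<comment> \<open>No derivative is involved: \<open>p = 1\<close>, and \<open>X\<close> itself serves.\<close>
    case 0
    then obtain c where "p = [:c:]" using deg by (auto elim: degree_eq_zeroE)
    then have p1: "p = 1" using monic by (simp add: one_pCons)
    have a1: "alpha k (P l) (M l) (Z l) = 1" unfolding alpha_X using 0 p1 by (simp add: N.prob_space)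
    show ?thesis
    proof (intro exI[of _ "distr N borel X"] exI[of _ "\<lambda>x. x"] conjI ballI impI)
      show "prob_space (distr N borel X)" by (rule N.prob_space_distr) simp
    qed (use 0 p1 a1 in \<open>auto simp: diff_class_def p_def integrable_distr_eq integral_distr\<close>)
  next
    case (Suc n)
    obtain S where S: "finite S" "card S = Suc n" "p = nodal_poly S"
      using orthogonal_poly_splits[of p N X] momX monic orthX sq deg Suc by auto
    have "(LINT w|N. X w ^ k * poly p (X w)) > 0"
    proof -
      \<comment> \<open>\<open>p\<close> and \<open>x ^ k\<close> differ by a polynomial of lower degree, so this expectation is that of \<open>p\<^sup>2\<close>.\<close>
      have "coeff (p - monom 1 k) i = 0" if "i \<ge> k" for i
        using that monic deg by (cases "i = k") (auto simp: coeff_eq_0)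
      then have "degree (p - monom 1 k) \<le> n" using Suc by (intro degree_le) auto
      then have "(LINT w|N. poly (p * (p - monom 1 k)) (X w)) = 0"
        using orthX[of "p - monom 1 k"] Suc by (simp del: poly_mult poly_diff)
      moreover have d: "degree (p * p) \<le> 2 * k" using degree_mult_le[of p p] deg by simp
      have "integrable N (\<lambda>w. poly (p * p) (X w))" by (rule poly_moment(1)[OF momX d])
      moreover have "integrable N (\<lambda>w. poly (monom 1 k * p) (X w))"
        by (rule poly_moment(1)[OF momX deg_monom])
      ultimately have "(LINT w|N. poly (p * p) (X w)) = (LINT w|N. X w ^ k * poly p (X w))"
        by (simp add: right_diff_distrib poly_monom mult.commute)
      then show ?thesis using sq by simp
    qed
    then have pos: "alpha k (P l) (M l) (Z l) > 0" unfolding alpha_X by simp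
    obtain N' where N': "prob_space N'" "sets N' = sets borel"
      "\<forall>F\<in>diff_class (Suc n) (poly p) N X. has_expectation N' ((deriv ^^ Suc n) F) \<longrightarrow>
              integrable N' ((deriv ^^ Suc n) F) \<and>
              (LINT w|N. poly p (X w) * F (X w)) =
                alpha k (P l) (M l) (Z l) * integral\<^sup>L N' ((deriv ^^ Suc n) F)"
      using stein_transform_exists[OF assms(10) Xm S, of "alpha k (P l) (M l) (Z l)"]
        momX orthX alpha_X pos Suc by auto
    have "(\<lambda>x. x) \<in> borel_measurable N'" using N'(2) by (simp cong: measurable_cong_sets)
    then show ?thesis
      using N'(1,3)[folded Suc] unfolding p_def[symmetric] by (intro exI[of _ N'] exI[of _ "\<lambda>x. x"]) auto
  qed
qed

end
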